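(* For every fixed $m\in\mathbb{N}$ with $m\geq 7$, the proportion of good vertices in the graph $L(k,m)$ tends to $\frac12$ as $k$ tends to infinity.
   Context: All graphs are finite and simple. For a connected graph $G=(V,E)$, $d_G(x,y)$ denotes the length of a shortest path from $x$ to $y$, and the Wiener index is $W(G)=\frac12\sum_{u,v\in V,\,u\neq v} d_G(u,v)$ (the sum over ordered pairs, so each unordered pair of distinct vertices contributes its distance once). $G-v$ is the graph obtained from $G$ by removing the vertex $v$. A vertex $v\in V$ is called good if $G-v$ is connected and $W(G)=W(G-v)$. The proportion of good vertices in $G$ is the number of good vertices of $G$ divided by $|V|$. Definition of $L(k,m)$ for $k,m\in\mathbb{N}$, $m\geq 7$, $k\geq\frac{m-3}{m-6}$: (1)-(2) The vertices are initially $u_0$, and $v_i$, $v^i_{1j}$, $v^i_{2j}$ for $i\in\{1,\dots,m\}$, $j\in\{1,\dots,k\}$, all distinct. For every $i$ and $j$ there is a path $(u_0,v^i_{1j},v^i_{2j},v_i)$ of length $3$, i.e. edges $\{u_0,v^i_{1j}\}$, $\{v^i_{1j},v^i_{2j}\}$, $\{v^i_{2j},v_i\}$. (For fixed $i$, the $k$ paths share exactly the vertices $u_0$ and $v_i$ and form a block; different blocks share exactly the vertex $u_0$.) (3) For all $i_1\neq i_2$ in $\{1,\dots,m\}$ and all $j_1,j_2\in\{1,\dots,k\}$ add the edge $\{v^{i_1}_{1j_1},v^{i_2}_{1j_2}\}$. (4) Add a path $(u_0,u_1,\dots,u_d)$ with new vertices $u_1,\dots,u_d$, where $d=\Big\lfloor\frac{\sqrt{8km-48k-8m+33}+1}{2}\Big\rfloor$.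 (5) Add one new vertex $u'_t$ adjacent only to $u_t$, where $t=km-6k-m+3-\frac{(d+1)(d-2)}{2}$ (one has $0\leq t\leq d$; if $t=0$ the new vertex $u'_0$ is attached to $u_0$). *)

theory Defs
  imports Complex_Main "Graph_Theory.Graph_Theory"
begin

text \<open>
  Finite simple graphs are the locale \<^locale>\<open>graph\<close> of the library: an undirected
  edge is a pair of opposite arcs.
\<close>

definition gdist :: "('a, 'b) pre_digraph \<Rightarrow> 'a \<Rightarrow> 'a \<Rightarrow> real" where
  "gdist G u v = real_of_ereal (wf_digraph.\<mu> G (\<lambda>_. 1) u v)"

lemma (in wf_digraph) awalk_cost_unit: "awalk_cost (\<lambda>_. 1) p = real (length p)"
  by (induction p) auto

lemma (in fin_digraph) gdist_eq_shortest_path_length: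
  assumes "u \<rightarrow>\<^sup>* v"
  shows "gdist G u v = real (LEAST n. \<exists>p. apath u p v \<and> length p = n)"
proof -
  obtain p where p: "apath u p v" "\<mu> (\<lambda>_. 1) u v = ereal (awalk_cost (\<lambda>_. 1) p)"
    using min_cost_awalk[OF assms, of "\<lambda>_. 1"] by auto
  have "length p \<le> length q" if "apath u q v" for q
    using min_cost_le_walk_cost[of u q v "\<lambda>_. 1"] that p(2)
    by (auto simp: apath_def awalk_cost_unit)
  then have "(LEAST n. \<exists>p. apath u p v \<and> length p = n) = length p"
    using p(1) by (intro Least_equality) auto
  then show ?thesis
    using p(2) by (simp add: gdist_def awalk_cost_unit)
qed

definition wiener_index :: "('a, 'b) pre_digraph \<Rightarrow> real" where
  "wiener_index G = (1 / 2) * (\<Sum>u\<in>verts G. \<Sum>v\<in>verts G - {u}. gdist G u v)"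

definition good_vertex :: "('a, 'b) pre_digraph \<Rightarrow> 'a \<Rightarrow> bool" where
  "good_vertex G v \<longleftrightarrow> v \<in> verts G \<and>
     Digraph_Component.connected (pre_digraph.del_vert G v) \<and>
     wiener_index G = wiener_index (pre_digraph.del_vert G v)"

definition good_proportion :: "('a, 'b) pre_digraph \<Rightarrow> real" where
  "good_proportion G = real (card {v \<in> verts G. good_vertex G v}) / real (card (verts G))"

text \<open>
  \<open>U s\<close> is \<open>u\<^sub>s\<close>, \<open>U'\<close> is the extra pendant vertex, \<open>V i\<close> is \<open>v\<^sub>i\<close>, and
  \<open>V1 i j\<close>, \<open>V2 i j\<close> are the inner vertices of the \<open>j\<close>-th path of the \<open>i\<close>-th block,
  \<open>V1 i j\<close> being the one adjacent to \<open>u\<^sub>0\<close>.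
\<close>

datatype L_vert = U nat | U' | V nat | V1 nat nat | V2 nat nat

definition L_d :: "nat \<Rightarrow> nat \<Rightarrow> nat" where
  "L_d k m = nat \<lfloor>(sqrt (8 * real k * real m - 48 * real k - 8 * real m + 33) + 1) / 2\<rfloor>"

text \<open>
  For \<open>m \<ge> 7\<close> and \<open>k \<ge> (m - 3) / (m - 6)\<close> the division below is exact and the integer is
  nonnegative, so neither \<open>div\<close> nor \<open>nat\<close> changes the value; see \<open>L_t_eq\<close>. Outside that
  range the graph is a dummy value.
\<close>

definition L_t :: "nat \<Rightarrow> nat \<Rightarrow> nat" where
  "L_t k m = nat (int k * int m - 6 * int k - int m + 3
                    - ((int (L_d k m) + 1) * (int (L_d k m) - 2)) div 2)"

definition L_graph :: "nat \<Rightarrow> nat \<Rightarrow> L_vert pair_pre_digraph" where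
  "L_graph k m = \<lparr>
     pverts = {U s | s. s \<le> L_d k m} \<union> {U'} \<union> {V i | i. i \<in> {1..m}}
       \<union> {V1 i j | i j. i \<in> {1..m} \<and> j \<in> {1..k}}
       \<union> {V2 i j | i j. i \<in> {1..m} \<and> j \<in> {1..k}},
     parcs =
       ({(U 0, V1 i j) | i j. i \<in> {1..m} \<and> j \<in> {1..k}}
       \<union> {(V1 i j, V2 i j) | i j. i \<in> {1..m} \<and> j \<in> {1..k}}
       \<union> {(V2 i j, V i) | i j. i \<in> {1..m} \<and> j \<in> {1..k}}
       \<union> {(V1 i1 j1, V1 i2 j2) | i1 i2 j1 j2.
            i1 \<in> {1..m} \<and> i2 \<in> {1..m} \<and> i1 \<noteq> i2 \<and> j1 \<in> {1..k} \<and> j2 \<in> {1..k}}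
       \<union> {(U s, U (Suc s)) | s. s < L_d k m}
       \<union> {(U (L_t k m), U')})\<^sup>s \<rparr>"

lemma L_t_eq_le:
  fixes k m :: nat
  assumes m: "m \<ge> 7" and k: "real k \<ge> (real m - 3) / (real m - 6)"
  shows L_t_eq: "real (L_t k m) = real k * real m - 6 * real k - real m + 3
            - (real (L_d k m) + 1) * (real (L_d k m) - 2) / 2"
    and L_t_le: "L_t k m \<le> L_d k m"
proof -
  define N where "N = int k * int m - 6 * int k - int m + 3"
  define d where "d = int (L_d k m)"
  have "real m - 3 \<le> real k * (real m - 6)"
    using m k by (simp add: field_simps)
  then have "real_of_int N \<ge> 0"
    by (simp add: N_def algebra_simps)
  then have N: "N \<ge> 0" by simp
  define s where "s = sqrt (8 * real_of_int N + 9)"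
  have s2: "s ^ 2 = 8 * real_of_int N + 9" and s0: "s \<ge> 0"
    using N by (auto simp: s_def)
  have s3: "s \<ge> 3"
    unfolding s_def using N by (intro real_le_rsqrt) simp
  have "sqrt (8 * real k * real m - 48 * real k - 8 * real m + 33) = s"
    by (simp add: s_def N_def algebra_simps)
  then have d: "d = \<lfloor>(s + 1) / 2\<rfloor>"
    using s0 by (simp add: d_def L_d_def)
  have lo: "2 * real_of_int d - 1 \<le> s" and hi: "s < 2 * real_of_int d + 1"
    using floor_correct[of "(s + 1) / 2"] unfolding d[symmetric] by auto
  have d2: "d \<ge> 2" using hi s3 by linarith
  have "(2 * real_of_int d - 1) ^ 2 \<le> s ^ 2" "s ^ 2 < (2 * real_of_int d + 1) ^ 2"
    using lo hi s0 d2 by (auto intro!: power_mono power_strict_mono)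
  then have "real_of_int ((2 * d - 1) ^ 2) \<le> real_of_int (8 * N + 9)"
            "real_of_int (8 * N + 9) < real_of_int ((2 * d + 1) ^ 2)"
    unfolding s2 by simp_all
  then have b: "(2 * d - 1) ^ 2 \<le> 8 * N + 9" "8 * N + 9 < (2 * d + 1) ^ 2"
    by (simp_all only: of_int_le_iff of_int_less_iff)
  have ev: "even ((d + 1) * (d - 2))" by auto
  then obtain q where q: "(d + 1) * (d - 2) = 2 * q" by blast
  have q': "2 * q = d ^ 2 - d - 2"
    using q by (simp add: algebra_simps power2_eq_square)
  have qN: "q \<le> N" "N \<le> q + d"
    using b q' by (auto simp: power2_eq_square algebra_simps)
  have t: "int (L_t k m) = N - q"
    using qN q by (simp add: L_t_def N_def d_def)
  show "L_t k m \<le> L_d k m"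
    using t qN by (simp add: d_def)
  have "real_of_int ((d + 1) * (d - 2)) = 2 * real_of_int q"
    unfolding q by simp
  moreover have "real (L_t k m) = real_of_int N - real_of_int q"
    using t by linarith
  ultimately show "real (L_t k m) = real k * real m - 6 * real k - real m + 3
            - (real (L_d k m) + 1) * (real (L_d k m) - 2) / 2"
    by (simp add: N_def d_def)
qed

lemma L_graph_is_graph:
  fixes k m :: nat
  assumes "m \<ge> 7" and "real k \<ge> (real m - 3) / (real m - 6)"
  shows "pair_graph (L_graph k m)"
proof -
  have t: "L_t k m \<le> L_d k m" using L_t_le[OF assms] .
  have *: "pverts (L_graph k m) = U ` {..L_d k m} \<union> {U'} \<union> V ` {1..m}
       \<union> (\<lambda>(i, j). V1 i j) ` ({1..m} \<times> {1..k}) \<union> (\<lambda>(i, j). V2 i j) ` ({1..m} \<times> {1..k})"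
    by (auto simp: L_graph_def)
  have fin: "finite (pverts (L_graph k m))"
    unfolding * by simp
  have sub: "parcs (L_graph k m) \<subseteq> pverts (L_graph k m) \<times> pverts (L_graph k m)"
    using t by (auto simp: L_graph_def symcl_def)
  have irr: "a \<noteq> b" if "(a, b) \<in> parcs (L_graph k m)" for a b
    using that by (auto simp: L_graph_def symcl_def)
  have "sym (parcs (L_graph k m))"
    by (auto simp: L_graph_def symcl_def sym_def)
  then have sy: "symmetric (with_proj (L_graph k m))"
    by (simp add: symmetric_def)
  show ?thesis
    using sub irr sy fin finite_subset[OF sub]
    by unfold_locales auto
qed

lemma L_graph_connected:
  fixes k m :: nat
  assumes "m \<ge> 7" and "real k \<ge> (real m - 3) / (real m - 6)"
  shows "Digraph_Component.connected (with_proj (L_graph k m))"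
proof -
  interpret pair_graph "L_graph k m" using L_graph_is_graph[OF assms] .
  let ?G = "with_proj (L_graph k m)"
  have t: "L_t k m \<le> L_d k m" using L_t_le[OF assms] .
  have "real m - 3 > 0" "real m - 6 > 0" using assms(1) by auto
  then have "(real m - 3) / (real m - 6) > 0" by (rule divide_pos_pos)
  then have k: "1 \<le> k" using assms(2) by linarith
  have U: "U 0 \<rightarrow>\<^sup>*\<^bsub>?G\<^esub> U s" if "s \<le> L_d k m" for s
    using that
  proof (induction s)
    case 0
    have "U 0 \<in> pverts (L_graph k m)" by (simp add: L_graph_def)
    then show ?case by auto
  next
    case (Suc s)
    have "(U s, U (Suc s)) \<in> parcs (L_graph k m)"
      using Suc.prems by (auto simp: L_graph_def symcl_def)
    then show ?case using Suc by (auto intro: reachable_adj_trans)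
  qed
  have U': "U 0 \<rightarrow>\<^sup>*\<^bsub>?G\<^esub> U'"
  proof -
    have "(U (L_t k m), U') \<in> parcs (L_graph k m)"
      by (auto simp: L_graph_def symcl_def)
    then show ?thesis using U[OF t] by (auto intro: reachable_adj_trans)
  qed
  have V1: "U 0 \<rightarrow>\<^sup>*\<^bsub>?G\<^esub> V1 i j" and V2: "U 0 \<rightarrow>\<^sup>*\<^bsub>?G\<^esub> V2 i j" and V: "U 0 \<rightarrow>\<^sup>*\<^bsub>?G\<^esub> V i"
    if "i \<in> {1..m}" "j \<in> {1..k}" for i j
  proof -
    have a: "(U 0, V1 i j) \<in> parcs (L_graph k m)" "(V1 i j, V2 i j) \<in> parcs (L_graph k m)"
      "(V2 i j, V i) \<in> parcs (L_graph k m)"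
      using that by (auto simp: L_graph_def symcl_def)
    show 1: "U 0 \<rightarrow>\<^sup>*\<^bsub>?G\<^esub> V1 i j" using a(1) by auto
    show 2: "U 0 \<rightarrow>\<^sup>*\<^bsub>?G\<^esub> V2 i j" using 1 a(2) by (auto intro: reachable_adj_trans)
    show "U 0 \<rightarrow>\<^sup>*\<^bsub>?G\<^esub> V i" using 2 a(3) by (auto intro: reachable_adj_trans)
  qed
  have reach: "U 0 \<rightarrow>\<^sup>*\<^bsub>?G\<^esub> x" if "x \<in> pverts (L_graph k m)" for x
  proof -
    consider s where "x = U s" "s \<le> L_d k m" | "x = U'" | i where "x = V i" "i \<in> {1..m}"
      | i j where "x = V1 i j \<or> x = V2 i j" "i \<in> {1..m}" "j \<in> {1..k}"
      using \<open>x \<in> pverts (L_graph k m)\<close> unfolding L_graph_def by fastforce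
    then show ?thesis
      using U U' V1 V2 V[of _ 1] k by cases auto
  qed
  have ne: "U 0 \<in> pverts (L_graph k m)" by (simp add: L_graph_def)
  have "strongly_connected ?G"
  proof (rule strongly_connectedI)
    show "verts ?G \<noteq> {}" using ne by auto
    fix x y assume "x \<in> verts ?G" "y \<in> verts ?G"
    then have "x \<rightarrow>\<^sup>*\<^bsub>?G\<^esub> U 0" "U 0 \<rightarrow>\<^sup>*\<^bsub>?G\<^esub> y"
      using reach symmetric_reachable' by auto
    then show "x \<rightarrow>\<^sup>*\<^bsub>?G\<^esub> y" by (rule reachable_trans)
  qed
  then show ?thesis
    unfolding Digraph_Component.connected_def strongly_connected_def
    using reachable_mk_symmetric_eq[OF sym_arcs] by simp
qed

end

theory Submission
  imports Defs "HOL-Real_Asymp.Real_Asymp"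
begin

text \<open>
  \<open>L k m\<close> has \<open>2 * k * m + m + d + 2\<close> vertices. The vertices \<open>V1 i j\<close> are all good and the
  vertices \<open>V2 i j\<close> are all bad; there are \<open>k * m\<close> of each kind, and the other \<open>m + d + 2\<close> vertices
  are negligible because \<open>d\<close> grows like the square root of \<open>k\<close>.

  To compare Wiener indices, fix a path \<open>U 0, V1 a b, V2 a b, V a\<close>. Another path \<open>b'\<close> of block
  \<open>a\<close> has the same neighbours outside, so folding path \<open>b\<close> onto path \<open>b'\<close> is a retraction of the
  graph onto the graph \<open>H\<close> without \<open>V1 a b\<close> and \<open>V2 a b\<close>. A retraction does not increase
  distances (\<open>gdist_retract\<close>), so \<open>H\<close> is isometric in \<open>L k m\<close> and in both graphs with one of these
  two vertices removed. Hence the three Wiener indices differ only by the distances from \<open>V1 a b\<close>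
  and \<open>V2 a b\<close> to \<open>H\<close>. Each of these four families of distances is written down explicitly and
  certified by \<open>gdist_eq_potential\<close>: a function that is zero at the source, changes by at most one
  along each edge and has a predecessor for every other vertex is the distance from the source.

  Removing \<open>V2 a b\<close> lengthens only the distance between \<open>V1 a b\<close> and \<open>V a\<close>, by two, and this is
  less than the distances that disappear, so the Wiener index drops. Removing \<open>V1 a b\<close> turns
  \<open>V2 a b\<close> into a leaf at \<open>V a\<close>; the loss and the gain then cancel exactly if
  \<open>t + (d + 1) * (d - 2) / 2 = k * m - 6 * k - m + 3\<close>, which is how \<open>t\<close> and \<open>d\<close> are chosen
  (\<open>balance\<close>).
\<close>

section \<open>Distances in digraphs\<close>

lemma dominates_del_vert:
  "x \<rightarrow>\<^bsub>pre_digraph.del_vert G v\<^esub> y \<longleftrightarrow> x \<rightarrow>\<^bsub>G\<^esub> y \<and> x \<noteq> v \<and> y \<noteq> v"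
  by (auto simp: arcs_ends_def arc_to_ends_def pre_digraph.del_vert_def)

lemma (in wf_digraph) awalk_potential_bound:
  fixes f :: "'a \<Rightarrow> nat"
  assumes "\<And>x y. x \<rightarrow> y \<Longrightarrow> f y \<le> Suc (f x)" and "awalk u p v"
  shows "f v \<le> f u + length p"
  using assms(2)
proof (induction p arbitrary: u)
  case Nil
  then show ?case by (simp add: awalk_Nil_iff)
next
  case (Cons e p)
  then have e: "e \<in> arcs G" "u = tail G e" and p: "awalk (head G e) p v"
    by (auto simp: awalk_Cons_iff)
  have "u \<rightarrow> head G e"
    using e by (intro dominatesI[of e]) (auto simp: arc_to_ends_def)
  then show ?case
    using assms(1) Cons.IH[OF p] by fastforce
qed

text \<open>
  Following parents from \<open>v\<close> lowers \<open>f\<close> by one at each step and can only end at \<open>u\<close>. Besides an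
  upper bound for the distance this yields reachability of every vertex from \<open>u\<close>.
\<close>

lemma (in wf_digraph) awalk_along_parents:
  fixes f :: "'a \<Rightarrow> nat"
  assumes u: "u \<in> verts G" "f u = 0"
    and parent: "\<And>x. x \<in> verts G \<Longrightarrow> x \<noteq> u \<Longrightarrow> par x \<rightarrow> x \<and> f x = Suc (f (par x))"
    and "v \<in> verts G"
  shows "\<exists>p. awalk u p v \<and> length p = f v"
  using assms(4)
proof (induction "f v" arbitrary: v)
  case 0
  then have "v = u"
    using parent[of v] by force
  then show ?case
    using u by (intro exI[of _ "[]"]) (simp add: awalk_Nil_iff)
next
  case (Suc n)
  then have "v \<noteq> u" using u by auto
  then have par: "par v \<rightarrow> v" "f v = Suc (f (par v))"
    using parent Suc.prems by auto
  from par(1) obtain e where e: "e \<in> arcs G" "tail G e = par v" "head G e = v"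
    by (auto simp: arcs_ends_def arc_to_ends_def)
  have "n = f (par v)" "par v \<in> verts G"
    using par Suc.hyps by (auto dest: adj_in_verts)
  then obtain p where p: "awalk u p (par v)" "length p = f (par v)"
    using Suc.hyps(1) by blast
  have "awalk (par v) [e] v"
    using e by (auto simp: awalk_simps)
  then have "awalk u (p @ [e]) v"
    using p by (auto intro: awalk_appendI)
  then show ?case
    using p par by (intro exI[of _ "p @ [e]"]) simp
qed

text \<open>
  The Lipschitz condition bounds the length of every walk from below, the walk along parents attains
  this bound. Distances from \<open>u\<close> can thus be verified edge by edge.
\<close>

lemma (in wf_digraph) gdist_eq_potential:
  fixes f :: "'a \<Rightarrow> nat"
  assumes u: "u \<in> verts G" "f u = 0"
    and lip: "\<And>x y. x \<rightarrow> y \<Longrightarrow> f y \<le> Suc (f x)"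
    and parent: "\<And>x. x \<in> verts G \<Longrightarrow> x \<noteq> u \<Longrightarrow> par x \<rightarrow> x \<and> f x = Suc (f (par x))"
    and v: "v \<in> verts G"
  shows "gdist G u v = real (f v)"
proof -
  obtain p where p: "awalk u p v" "length p = f v"
    using awalk_along_parents[OF u parent v] by blast
  have "\<mu> (\<lambda>_. 1) u v \<le> ereal (real (f v))"
    using min_cost_le_walk_cost[OF p(1), of "\<lambda>_. 1"] p(2) by (simp add: awalk_cost_unit)
  moreover have "ereal (real (f v)) \<le> \<mu> (\<lambda>_. 1) u v"
    unfolding \<mu>_def
    using awalk_potential_bound[of f, OF lip] u
    by (intro INF_greatest) (fastforce simp: awalk_cost_unit)
  ultimately have "\<mu> (\<lambda>_. 1) u v = ereal (real (f v))" by (rule antisym)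
  then show ?thesis by (simp add: gdist_def)
qed

lemma awalk_hom:
  assumes G: "wf_digraph G" and H: "wf_digraph H"
    and f: "\<And>x. x \<in> verts G \<Longrightarrow> f x \<in> verts H" "\<And>x y. x \<rightarrow>\<^bsub>G\<^esub> y \<Longrightarrow> f x \<rightarrow>\<^bsub>H\<^esub> f y"
    and "pre_digraph.awalk G u p v"
  shows "\<exists>q. pre_digraph.awalk H (f u) q (f v) \<and> length q = length p"
  using assms(5)
proof (induction p arbitrary: u)
  case Nil
  then show ?case
    using f(1) by (intro exI[of _ "[]"])
      (auto simp: wf_digraph.awalk_Nil_iff[OF G] wf_digraph.awalk_Nil_iff[OF H])
next
  case (Cons e p)
  then have e: "e \<in> arcs G" "u = tail G e" and p: "pre_digraph.awalk G (head G e) p v"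
    by (auto simp: wf_digraph.awalk_Cons_iff[OF G])
  obtain q where q: "pre_digraph.awalk H (f (head G e)) q (f v)" "length q = length p"
    using Cons.IH[OF p] by blast
  have "u \<rightarrow>\<^bsub>G\<^esub> head G e"
    using e by (intro wf_digraph.dominatesI[OF G, of e]) (auto simp: arc_to_ends_def)
  then have "f u \<rightarrow>\<^bsub>H\<^esub> f (head G e)" by (rule f)
  then obtain e' where "e' \<in> arcs H" "tail H e' = f u" "head H e' = f (head G e)"
    by (auto simp: arcs_ends_def arc_to_ends_def)
  then show ?case
    using q by (intro exI[of _ "e' # q"]) (simp add: wf_digraph.awalk_Cons_iff[OF H])
qed

text \<open>
  The inequality is stated for the extended-real \<open>\<mu>\<close>: for \<open>gdist\<close> it would fail when \<open>v\<close> is not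
  reachable from \<open>u\<close>, as the infinite distance is then converted to \<open>0\<close>.
\<close>

lemma mu_hom_le:
  assumes G: "wf_digraph G" and H: "wf_digraph H"
    and "\<And>x. x \<in> verts G \<Longrightarrow> f x \<in> verts H" "\<And>x y. x \<rightarrow>\<^bsub>G\<^esub> y \<Longrightarrow> f x \<rightarrow>\<^bsub>H\<^esub> f y"
  shows "wf_digraph.\<mu> H (\<lambda>_. 1) (f u) (f v) \<le> wf_digraph.\<mu> G (\<lambda>_. 1) u v"
  unfolding wf_digraph.\<mu>_def[OF G] wf_digraph.\<mu>_def[OF H]
proof (rule INF_mono)
  fix p assume "p \<in> {p. pre_digraph.awalk G u p v}"
  then obtain q where "pre_digraph.awalk H (f u) q (f v)" "length q = length p"
    using awalk_hom[of G H f u p v] assms by blast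
  then show "\<exists>q\<in>{q. pre_digraph.awalk H (f u) q (f v)}.
      ereal (wf_digraph.awalk_cost (\<lambda>_. 1) q) \<le> ereal (wf_digraph.awalk_cost (\<lambda>_. 1) p)"
    by (intro bexI[of _ q])
      (auto simp: wf_digraph.awalk_cost_unit[OF G] wf_digraph.awalk_cost_unit[OF H])
qed

text \<open>
  The homomorphism \<open>f\<close> maps walks of \<open>G\<close> to walks of \<open>H\<close> of the same length, and the inclusion does
  so in the other direction.
\<close>

lemma gdist_retract:
  assumes G: "wf_digraph G" and H: "wf_digraph H"
    and sub: "verts H \<subseteq> verts G" "\<And>x y. x \<rightarrow>\<^bsub>H\<^esub> y \<Longrightarrow> x \<rightarrow>\<^bsub>G\<^esub> y"
    and hom: "\<And>x. x \<in> verts G \<Longrightarrow> f x \<in> verts H" "\<And>x y. x \<rightarrow>\<^bsub>G\<^esub> y \<Longrightarrow> f x \<rightarrow>\<^bsub>H\<^esub> f y"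
    and fix_u: "f u = u" and fix_v: "f v = v"
  shows "gdist G u v = gdist H u v"
proof -
  have "wf_digraph.\<mu> H (\<lambda>_. 1) (f u) (f v) \<le> wf_digraph.\<mu> G (\<lambda>_. 1) u v"
    using G H hom by (rule mu_hom_le)
  moreover have "wf_digraph.\<mu> G (\<lambda>_. 1) (id u) (id v) \<le> wf_digraph.\<mu> H (\<lambda>_. 1) u v"
    using sub by (intro mu_hom_le G H) auto
  ultimately show ?thesis
    by (simp add: gdist_def fix_u fix_v)
qed

lemma (in sym_digraph) awalk_reverse:
  assumes "awalk u p v"
  shows "\<exists>q. awalk v q u \<and> length q = length p"
  using assms
proof (induction p arbitrary: u)
  case Nil
  then show ?case by (intro exI[of _ "[]"]) (auto simp: awalk_Nil_iff)
next
  case (Cons e p)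
  then have e: "e \<in> arcs G" "u = tail G e" and p: "awalk (head G e) p v"
    by (auto simp: awalk_Cons_iff)
  obtain q where q: "awalk v q (head G e)" "length q = length p"
    using Cons.IH[OF p] by blast
  have "u \<rightarrow> head G e"
    using e by (intro dominatesI[of e]) (auto simp: arc_to_ends_def)
  then have "head G e \<rightarrow> u" using sym_arcs by (auto simp: symmetric_def dest: symD)
  then obtain e' where "e' \<in> arcs G" "tail G e' = head G e" "head G e' = u"
    by (auto simp: arcs_ends_def arc_to_ends_def)
  then have "awalk (head G e) [e'] u" by (auto simp: awalk_simps)
  then have "awalk v (q @ [e']) u" using q by (auto intro: awalk_appendI)
  then show ?case using q by (intro exI[of _ "q @ [e']"]) simp
qed

lemma (in sym_digraph) gdist_commute: "gdist G u v = gdist G v u"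
proof -
  have "\<mu> (\<lambda>_. 1) u v \<le> \<mu> (\<lambda>_. 1) v u" for u v
    unfolding \<mu>_def
  proof (rule INF_mono)
    fix p assume "p \<in> {p. awalk v p u}"
    then obtain q where "awalk u q v" "length q = length p" using awalk_reverse by blast
    then show "\<exists>q\<in>{q. awalk u q v}. ereal (awalk_cost (\<lambda>_. 1) q) \<le> ereal (awalk_cost (\<lambda>_. 1) p)"
      by (intro bexI[of _ q]) (auto simp: awalk_cost_unit)
  qed
  then have "\<mu> (\<lambda>_. 1) u v = \<mu> (\<lambda>_. 1) v u" by (intro antisym)
  then show ?thesis by (simp add: gdist_def)
qed

lemma (in sym_digraph) sym_digraph_del_vert: "sym_digraph (del_vert v)"
proof -
  interpret D: wf_digraph "del_vert v" by (rule wf_digraph_del_vert)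
  show ?thesis
    using sym_arcs by unfold_locales (auto simp: symmetric_def sym_def dominates_del_vert)
qed

lemma (in sym_digraph) connected_if_reachable_from:
  assumes "u \<in> verts G" and "\<And>x. x \<in> verts G \<Longrightarrow> u \<rightarrow>\<^sup>* x"
  shows "Digraph_Component.connected G"
proof -
  have "strongly_connected G"
  proof (rule strongly_connectedI)
    show "verts G \<noteq> {}" using assms(1) by auto
    fix x y assume "x \<in> verts G" "y \<in> verts G"
    then have "x \<rightarrow>\<^sup>* u" "u \<rightarrow>\<^sup>* y"
      using assms(2) symmetric_reachable[OF sym_arcs] by auto
    then show "x \<rightarrow>\<^sup>* y" by (rule reachable_trans)
  qed
  then show ?thesis
    unfolding Digraph_Component.connected_def strongly_connected_def
    using reachable_mk_symmetric_eq[OF sym_arcs] by simp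
qed

section \<open>Sums over pairs\<close>

definition pair_sum :: "'a set \<Rightarrow> ('a \<Rightarrow> 'a \<Rightarrow> real) \<Rightarrow> real" where
  "pair_sum S \<delta> = (1 / 2) * (\<Sum>u\<in>S. \<Sum>v\<in>S - {u}. \<delta> u v)"

lemma wiener_index_eq_pair_sum: "wiener_index G = pair_sum (verts G) (gdist G)"
  by (simp add: wiener_index_def pair_sum_def)

lemma pair_sum_cong:
  assumes "\<And>u v. u \<in> S \<Longrightarrow> v \<in> S \<Longrightarrow> \<delta> u v = \<epsilon> u v"
  shows "pair_sum S \<delta> = pair_sum S \<epsilon>"
  unfolding pair_sum_def using assms by (intro arg_cong2[of _ _ _ _ "(*)"] sum.cong) auto

lemma pair_sum_insert:
  assumes "finite S" "a \<notin> S" and sym: "\<And>u v. \<delta> u v = \<delta> v u"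
  shows "pair_sum (insert a S) \<delta> = pair_sum S \<delta> + (\<Sum>x\<in>S. \<delta> a x)"
proof -
  have "(\<Sum>v\<in>insert a S - {u}. \<delta> u v) = \<delta> a u + (\<Sum>v\<in>S - {u}. \<delta> u v)" if "u \<in> S" for u
  proof -
    have "insert a S - {u} = insert a (S - {u})" using that assms(2) by auto
    then show ?thesis using assms by (simp add: sym[of u a])
  qed
  then have "(\<Sum>u\<in>S. \<Sum>v\<in>insert a S - {u}. \<delta> u v)
      = (\<Sum>u\<in>S. \<delta> a u) + (\<Sum>u\<in>S. \<Sum>v\<in>S - {u}. \<delta> u v)"
    by (simp add: sum.distrib)
  moreover have "insert a S - {a} = S" using assms(2) by auto
  ultimately show ?thesis
    using assms by (simp add: pair_sum_def field_simps)
qed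

text \<open>
  Within a block, and among the blocks, the summands below depend only on whether the index is that
  of the distinguished path.
\<close>

lemma sum_if_eq:
  fixes c e :: real
  assumes "finite I" "a \<in> I"
  shows "(\<Sum>i\<in>I. if i = a then c else e) = c + (real (card I) - 1) * e"
proof -
  have "(\<Sum>i\<in>I. if i = a then c else e) = c + (\<Sum>i\<in>I - {a}. if i = a then c else e)"
    using assms by (simp add: sum.remove)
  also have "(\<Sum>i\<in>I - {a}. if i = a then c else e) = (\<Sum>i\<in>I - {a}. e)"
    by (intro sum.cong) auto
  also have "\<dots> = (real (card I) - 1) * e"
    using assms card_gt_0_iff[of I] by (auto simp: of_nat_diff Suc_le_eq)
  finally show ?thesis .
qed

section \<open>Edges of the graph and sums over its vertices\<close>

lemma verts_L_graph [simp]: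
  "U s \<in> pverts (L_graph k m) \<longleftrightarrow> s \<le> L_d k m"
  "U' \<in> pverts (L_graph k m)"
  "V i \<in> pverts (L_graph k m) \<longleftrightarrow> i \<in> {1..m}"
  "V1 i j \<in> pverts (L_graph k m) \<longleftrightarrow> i \<in> {1..m} \<and> j \<in> {1..k}"
  "V2 i j \<in> pverts (L_graph k m) \<longleftrightarrow> i \<in> {1..m} \<and> j \<in> {1..k}"
  by (auto simp: L_graph_def)

lemma L_graph_edges [simp]:
  "(U s, U s') \<in> parcs (L_graph k m) \<longleftrightarrow>
     s \<le> L_d k m \<and> s' \<le> L_d k m \<and> (s' = Suc s \<or> s = Suc s')"
  "(U s, U') \<in> parcs (L_graph k m) \<longleftrightarrow> s = L_t k m"
  "(U', U s) \<in> parcs (L_graph k m) \<longleftrightarrow> s = L_t k m"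
  "(U s, V1 i j) \<in> parcs (L_graph k m) \<longleftrightarrow> s = 0 \<and> i \<in> {1..m} \<and> j \<in> {1..k}"
  "(V1 i j, U s) \<in> parcs (L_graph k m) \<longleftrightarrow> s = 0 \<and> i \<in> {1..m} \<and> j \<in> {1..k}"
  "(V1 i j, V1 i' j') \<in> parcs (L_graph k m) \<longleftrightarrow>
     i \<in> {1..m} \<and> i' \<in> {1..m} \<and> i \<noteq> i' \<and> j \<in> {1..k} \<and> j' \<in> {1..k}"
  "(V1 i j, V2 i' j') \<in> parcs (L_graph k m) \<longleftrightarrow>
     i' = i \<and> j' = j \<and> i \<in> {1..m} \<and> j \<in> {1..k}"
  "(V2 i' j', V1 i j) \<in> parcs (L_graph k m) \<longleftrightarrow>
     i' = i \<and> j' = j \<and> i \<in> {1..m} \<and> j \<in> {1..k}"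
  "(V2 i j, V i') \<in> parcs (L_graph k m) \<longleftrightarrow> i' = i \<and> i \<in> {1..m} \<and> j \<in> {1..k}"
  "(V i', V2 i j) \<in> parcs (L_graph k m) \<longleftrightarrow> i' = i \<and> i \<in> {1..m} \<and> j \<in> {1..k}"
  by (auto simp: L_graph_def symcl_def)

lemma L_graph_non_edges [simp]:
  "(U', U') \<notin> parcs (L_graph k m)"
  "(U s, V i) \<notin> parcs (L_graph k m)" "(V i, U s) \<notin> parcs (L_graph k m)"
  "(U s, V2 i j) \<notin> parcs (L_graph k m)" "(V2 i j, U s) \<notin> parcs (L_graph k m)"
  "(U', V i) \<notin> parcs (L_graph k m)" "(V i, U') \<notin> parcs (L_graph k m)"
  "(U', V1 i j) \<notin> parcs (L_graph k m)" "(V1 i j, U') \<notin> parcs (L_graph k m)"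
  "(U', V2 i j) \<notin> parcs (L_graph k m)" "(V2 i j, U') \<notin> parcs (L_graph k m)"
  "(V i, V i') \<notin> parcs (L_graph k m)"
  "(V i', V1 i j) \<notin> parcs (L_graph k m)" "(V1 i j, V i') \<notin> parcs (L_graph k m)"
  "(V2 i j, V2 i' j') \<notin> parcs (L_graph k m)"
  by (auto simp: L_graph_def symcl_def)

lemma pverts_L_graph_eq:
  "pverts (L_graph k m) = U ` {..L_d k m} \<union> {U'} \<union> V ` {1..m}
     \<union> (\<lambda>(i, j). V1 i j) ` ({1..m} \<times> {1..k}) \<union> (\<lambda>(i, j). V2 i j) ` ({1..m} \<times> {1..k})"
  by (auto simp: L_graph_def)

lemma sum_L_graph:
  fixes f :: "L_vert \<Rightarrow> real"
  shows "(\<Sum>x\<in>pverts (L_graph k m). f x) =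
    (\<Sum>s\<le>L_d k m. f (U s)) + f U' + (\<Sum>i\<in>{1..m}. f (V i))
      + (\<Sum>i\<in>{1..m}. \<Sum>j\<in>{1..k}. f (V1 i j)) + (\<Sum>i\<in>{1..m}. \<Sum>j\<in>{1..k}. f (V2 i j))"
proof -
  have "(\<Sum>x\<in>(\<lambda>(i, j). V1 i j) ` ({1..m} \<times> {1..k}). f x)
      = (\<Sum>i\<in>{1..m}. \<Sum>j\<in>{1..k}. f (V1 i j))"
    by (subst sum.reindex) (auto simp: inj_on_def sum.cartesian_product intro!: sum.cong)
  moreover have "(\<Sum>x\<in>(\<lambda>(i, j). V2 i j) ` ({1..m} \<times> {1..k}). f x)
      = (\<Sum>i\<in>{1..m}. \<Sum>j\<in>{1..k}. f (V2 i j))"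
    by (subst sum.reindex) (auto simp: inj_on_def sum.cartesian_product intro!: sum.cong)
  moreover have "(\<Sum>x\<in>U ` {..L_d k m}. f x) = (\<Sum>s\<le>L_d k m. f (U s))"
    by (subst sum.reindex) (auto simp: inj_on_def)
  moreover have "(\<Sum>x\<in>V ` {1..m}. f x) = (\<Sum>i\<in>{1..m}. f (V i))"
    by (subst sum.reindex) (auto simp: inj_on_def)
  moreover have "U' \<notin> U ` {..L_d k m}" "(U ` {..L_d k m} \<union> {U'}) \<inter> V ` {1..m} = {}"
    "(U ` {..L_d k m} \<union> {U'} \<union> V ` {1..m}) \<inter> (\<lambda>(i, j). V1 i j) ` ({1..m} \<times> {1..k}) = {}"
    "(U ` {..L_d k m} \<union> {U'} \<union> V ` {1..m} \<union> (\<lambda>(i, j). V1 i j) ` ({1..m} \<times> {1..k}))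
      \<inter> (\<lambda>(i, j). V2 i j) ` ({1..m} \<times> {1..k}) = {}"
    by auto
  ultimately show ?thesis
    unfolding pverts_L_graph_eq by (simp add: sum.union_disjoint del: Un_insert_right)
qed

section \<open>Deleting a vertex of a path\<close>

text \<open>
  A distinguished path \<open>b\<close> of block \<open>a\<close> and a second path \<open>b'\<close> of the same block, which replaces it
  after the deletion of a vertex.
\<close>

locale L_path =
  fixes k m a b b' :: nat
  assumes m: "m \<ge> 7" and k: "real k \<ge> (real m - 3) / (real m - 6)"
    and a: "a \<in> {1..m}" and b: "b \<in> {1..k}" and b': "b' \<in> {1..k}" "b' \<noteq> b"
begin

abbreviation G :: "(L_vert, L_vert \<times> L_vert) pre_digraph" where
  "G \<equiv> with_proj (L_graph k m)"

abbreviation "d \<equiv> L_d k m"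
abbreviation "t \<equiv> L_t k m"

abbreviation G1 :: "(L_vert, L_vert \<times> L_vert) pre_digraph" where
  "G1 \<equiv> pre_digraph.del_vert G (V1 a b)"

abbreviation G2 :: "(L_vert, L_vert \<times> L_vert) pre_digraph" where
  "G2 \<equiv> pre_digraph.del_vert G (V2 a b)"

definition H :: "(L_vert, L_vert \<times> L_vert) pre_digraph" where
  "H = pre_digraph.del_vert G1 (V2 a b)"

sublocale pair_graph "L_graph k m"
  by (rule L_graph_is_graph[OF m k])

lemma t_le_d: "t \<le> d"
  by (rule L_t_le[OF m k])

lemma sym_digraph_G: "sym_digraph G" by unfold_locales

lemma sym_digraph_G1: "sym_digraph G1" by (rule sym_digraph_del_vert)

lemma sym_digraph_G2: "sym_digraph G2" by (rule sym_digraph_del_vert)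

lemma wf_digraph_H: "wf_digraph H"
  unfolding H_def using sym_digraph_G1
  by (rule wf_digraph.wf_digraph_del_vert[OF sym_digraph.axioms(1)])

lemma wf_digraph_G1: "wf_digraph G1" and wf_digraph_G2: "wf_digraph G2"
  by (rule wf_digraph_del_vert)+

lemma verts_G1: "verts G1 = pverts (L_graph k m) - {V1 a b}"
  and verts_G2: "verts G2 = pverts (L_graph k m) - {V2 a b}"
  and verts_H: "verts H = pverts (L_graph k m) - {V1 a b, V2 a b}"
  by (auto simp: H_def pre_digraph.del_vert_def)

lemma dominates_H: "x \<rightarrow>\<^bsub>H\<^esub> y \<longleftrightarrow>
    (x, y) \<in> parcs (L_graph k m) \<and> {x, y} \<inter> {V1 a b, V2 a b} = {}"
  by (auto simp: H_def dominates_del_vert)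

definition fold_path :: "L_vert \<Rightarrow> L_vert" where
  "fold_path x = (if x = V1 a b then V1 a b' else if x = V2 a b then V2 a b' else x)"

text \<open>
  No edge joins the two paths, and the neighbours of path \<open>b\<close> off the path are the neighbours of the
  corresponding vertices of path \<open>b'\<close>; hence folding preserves edges.
\<close>

lemma fold_path_edge:
  assumes "(x, y) \<in> parcs (L_graph k m)"
  shows "fold_path x \<rightarrow>\<^bsub>H\<^esub> fold_path y"
  using assms a b b'
  by (cases x; cases y) (auto simp: fold_path_def dominates_H)

lemma fold_path_in_verts: "x \<in> pverts (L_graph k m) \<Longrightarrow> fold_path x \<in> verts H"
  using a b' by (auto simp: fold_path_def verts_H)

lemma gdist_H:
  assumes K: "K \<in> {G, G1, G2}" and xy: "x \<in> verts H" "y \<in> verts H"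
  shows "gdist K x y = gdist H x y"
proof (rule gdist_retract[where f = fold_path])
  show "wf_digraph K"
    using K wf_digraph_axioms wf_digraph_G1 wf_digraph_G2 by auto
  show "wf_digraph H" by (rule wf_digraph_H)
  show "verts H \<subseteq> verts K"
    using K by (auto simp: verts_H verts_G1 verts_G2)
  show "u \<rightarrow>\<^bsub>K\<^esub> v" if "u \<rightarrow>\<^bsub>H\<^esub> v" for u v
    using K that by (auto simp: dominates_H dominates_del_vert)
  show "fold_path u \<in> verts H" if "u \<in> verts K" for u
    using K that by (intro fold_path_in_verts) (auto simp: verts_G1 verts_G2)
  show "fold_path u \<rightarrow>\<^bsub>H\<^esub> fold_path v" if "u \<rightarrow>\<^bsub>K\<^esub> v" for u v
    using K that by (intro fold_path_edge) (auto simp: dominates_del_vert)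
  show "fold_path x = x" "fold_path y = y"
    using xy by (auto simp: fold_path_def verts_H)
qed

text \<open>
  The next four functions are the distances from \<open>V1 a b\<close> and \<open>V2 a b\<close> in \<open>G\<close>, from \<open>V2 a b\<close> in
  \<open>G1\<close>, where every walk starts \<open>V2 a b, V a\<close>, and from \<open>V1 a b\<close> in \<open>G2\<close>, where the shortest way to
  \<open>V a\<close> is through a common neighbour of \<open>V1 a b\<close> and \<open>V1 a b'\<close>, then along path \<open>b'\<close>.
\<close>

definition dist_V1 :: "L_vert \<Rightarrow> nat" where
  "dist_V1 x = (case x of U s \<Rightarrow> s + 1 | U' \<Rightarrow> t + 2 | V i \<Rightarrow> if i = a then 2 else 3
     | V1 i j \<Rightarrow> if i = a then if j = b then 0 else 2 else 1
     | V2 i j \<Rightarrow> if i = a then if j = b then 1 else 3 else 2)"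

definition dist_V2 :: "L_vert \<Rightarrow> nat" where
  "dist_V2 x = (case x of U s \<Rightarrow> s + 2 | U' \<Rightarrow> t + 3 | V i \<Rightarrow> if i = a then 1 else 4
     | V1 i j \<Rightarrow> if i = a then if j = b then 1 else 3 else 2
     | V2 i j \<Rightarrow> if i = a then if j = b then 0 else 2 else 3)"

definition dist_V2_G1 :: "L_vert \<Rightarrow> nat" where
  "dist_V2_G1 x = (case x of U s \<Rightarrow> s + 4 | U' \<Rightarrow> t + 5 | V i \<Rightarrow> if i = a then 1 else 6
     | V1 i j \<Rightarrow> if i = a then 3 else 4
     | V2 i j \<Rightarrow> if i = a then if j = b then 0 else 2 else 5)"

definition dist_V1_G2 :: "L_vert \<Rightarrow> nat" where
  "dist_V1_G2 x = (if x = V a then 4 else dist_V1 x)"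

lemma gdist_V1:
  assumes "x \<in> pverts (L_graph k m)"
  shows "gdist G (V1 a b) x = dist_V1 x"
proof (rule gdist_eq_potential[where par = "\<lambda>x. case x of
      U s \<Rightarrow> if s = 0 then V1 a b else U (s - 1) | U' \<Rightarrow> U t | V i \<Rightarrow> V2 i b
    | V1 i j \<Rightarrow> if i = a then U 0 else V1 a b
    | V2 i j \<Rightarrow> V1 i j"])
  show "dist_V1 y \<le> Suc (dist_V1 x)" if "(x, y) \<in> parcs (L_graph k m)" for x y
    using that by (cases x; cases y) (auto simp: dist_V1_def)
qed (use assms a b t_le_d in \<open>auto simp: dist_V1_def split: L_vert.splits\<close>)

lemma gdist_V2:
  assumes "x \<in> pverts (L_graph k m)"
  shows "gdist G (V2 a b) x = dist_V2 x"
proof (rule gdist_eq_potential[where par = "\<lambda>x. case x of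
      U s \<Rightarrow> if s = 0 then V1 a b else U (s - 1) | U' \<Rightarrow> U t
    | V i \<Rightarrow> V2 i b
    | V1 i j \<Rightarrow> if i = a then V2 i j else V1 a b
    | V2 i j \<Rightarrow> if i = a then V a else V1 i j"])
  show "dist_V2 y \<le> Suc (dist_V2 x)" if "(x, y) \<in> parcs (L_graph k m)" for x y
    using that by (cases x; cases y) (auto simp: dist_V2_def)
qed (use assms a b t_le_d in \<open>auto simp: dist_V2_def split: L_vert.splits\<close>)

abbreviation par_V2_G1 :: "L_vert \<Rightarrow> L_vert" where
  "par_V2_G1 x \<equiv> (case x of
      U s \<Rightarrow> if s = 0 then V1 a b' else U (s - 1) | U' \<Rightarrow> U t
    | V i \<Rightarrow> V2 i b
    | V1 i j \<Rightarrow> if i = a then V2 i j else V1 a b'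
    | V2 i j \<Rightarrow> if i = a then V a else V1 i j)"

lemma par_V2_G1:
  assumes "x \<in> verts G1" "x \<noteq> V2 a b"
  shows "par_V2_G1 x \<rightarrow>\<^bsub>G1\<^esub> x \<and> dist_V2_G1 x = Suc (dist_V2_G1 (par_V2_G1 x))"
  using assms a b b' t_le_d
  by (auto simp: dist_V2_G1_def dominates_del_vert verts_G1 split: L_vert.splits)

lemma V2_in_G1: "V2 a b \<in> verts G1" "dist_V2_G1 (V2 a b) = 0"
  using a b by (auto simp: verts_G1 dist_V2_G1_def)

lemma gdist_V2_G1:
  assumes "x \<in> verts G1"
  shows "gdist G1 (V2 a b) x = dist_V2_G1 x"
proof (rule wf_digraph.gdist_eq_potential[OF wf_digraph_G1 V2_in_G1 _ par_V2_G1 assms])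
  show "dist_V2_G1 y \<le> Suc (dist_V2_G1 x)" if "x \<rightarrow>\<^bsub>G1\<^esub> y" for x y
    using that by (cases x; cases y) (auto simp: dist_V2_G1_def dominates_del_vert)
qed

lemma connected_G1: "Digraph_Component.connected G1"
proof (rule sym_digraph.connected_if_reachable_from[OF sym_digraph_G1 V2_in_G1(1)])
  fix x assume "x \<in> verts G1"
  then show "V2 a b \<rightarrow>\<^sup>*\<^bsub>G1\<^esub> x"
    using wf_digraph.awalk_along_parents[OF wf_digraph_G1 V2_in_G1 par_V2_G1]
      wf_digraph.reachable_awalk[OF wf_digraph_G1] by blast
qed

lemma gdist_V1_G2:
  assumes "x \<in> verts G2"
  shows "gdist G2 (V1 a b) x = dist_V1_G2 x"
proof (rule wf_digraph.gdist_eq_potential[OF wf_digraph_G2, where par = "\<lambda>x. case x of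
      U s \<Rightarrow> if s = 0 then V1 a b else U (s - 1) | U' \<Rightarrow> U t
    | V i \<Rightarrow> if i = a then V2 a b' else V2 i b
    | V1 i j \<Rightarrow> if i = a then U 0 else V1 a b
    | V2 i j \<Rightarrow> V1 i j"])
  show "dist_V1_G2 y \<le> Suc (dist_V1_G2 x)" if "x \<rightarrow>\<^bsub>G2\<^esub> y" for x y
    using that by (cases x; cases y) (auto simp: dist_V1_G2_def dist_V1_def dominates_del_vert)
qed (use assms a b b' t_le_d in \<open>auto simp: dist_V1_G2_def dist_V1_def dominates_del_vert verts_G2
       split: L_vert.splits\<close>)

text \<open>
  The part of the Wiener index that \<open>G\<close>, \<open>G1\<close> and \<open>G2\<close> have in common, \<open>H\<close> being isometric in each
  of them.
\<close>

definition core :: real where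
  "core = pair_sum (verts H) (gdist H)"

lemma finite_verts_H: "finite (verts H)"
  by (simp add: verts_H)

lemma not_in_verts_H: "V1 a b \<notin> verts H" "V2 a b \<notin> verts H"
  by (simp_all add: verts_H)

lemma verts_insert:
  "verts G = insert (V2 a b) (insert (V1 a b) (verts H))"
  "verts G1 = insert (V2 a b) (verts H)"
  "verts G2 = insert (V1 a b) (verts H)"
  using a b by (auto simp: verts_H verts_G1 verts_G2)

lemma pair_sum_H: "K \<in> {G, G1, G2} \<Longrightarrow> pair_sum (verts H) (gdist K) = core"
  unfolding core_def by (intro pair_sum_cong gdist_H)

lemma wiener_G:
  "wiener_index G = core + (\<Sum>x\<in>verts H. real (dist_V1 x)) + (\<Sum>x\<in>verts H. real (dist_V2 x)) + 1"
proof -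
  have "wiener_index G = core + (\<Sum>x\<in>verts H. gdist G (V1 a b) x)
      + (\<Sum>x\<in>insert (V1 a b) (verts H). gdist G (V2 a b) x)"
    unfolding wiener_index_eq_pair_sum verts_insert
    using gdist_commute
    by (simp add: pair_sum_insert finite_verts_H pair_sum_H not_in_verts_H)
  also have "(\<Sum>x\<in>verts H. gdist G (V1 a b) x) = (\<Sum>x\<in>verts H. real (dist_V1 x))"
    by (intro sum.cong gdist_V1) (auto simp: verts_H)
  also have "(\<Sum>x\<in>insert (V1 a b) (verts H). gdist G (V2 a b) x)
      = (\<Sum>x\<in>insert (V1 a b) (verts H). real (dist_V2 x))"
    using a b by (intro sum.cong gdist_V2) (auto simp: verts_H)
  also have "\<dots> = (\<Sum>x\<in>verts H. real (dist_V2 x)) + 1"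
    using finite_verts_H by (simp add: not_in_verts_H dist_V2_def)
  finally show ?thesis by simp
qed

lemma wiener_G1: "wiener_index G1 = core + (\<Sum>x\<in>verts H. real (dist_V2_G1 x))"
proof -
  have "wiener_index G1 = core + (\<Sum>x\<in>verts H. gdist G1 (V2 a b) x)"
    unfolding wiener_index_eq_pair_sum verts_insert
    using sym_digraph.gdist_commute[OF sym_digraph_G1]
    by (simp add: pair_sum_insert finite_verts_H pair_sum_H not_in_verts_H)
  also have "(\<Sum>x\<in>verts H. gdist G1 (V2 a b) x) = (\<Sum>x\<in>verts H. real (dist_V2_G1 x))"
    by (intro sum.cong gdist_V2_G1) (auto simp: verts_insert)
  finally show ?thesis .
qed

lemma wiener_G2: "wiener_index G2 = core + (\<Sum>x\<in>verts H. real (dist_V1_G2 x))"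
proof -
  have "wiener_index G2 = core + (\<Sum>x\<in>verts H. gdist G2 (V1 a b) x)"
    unfolding wiener_index_eq_pair_sum verts_insert
    using sym_digraph.gdist_commute[OF sym_digraph_G2]
    by (simp add: pair_sum_insert finite_verts_H pair_sum_H not_in_verts_H)
  also have "(\<Sum>x\<in>verts H. gdist G2 (V1 a b) x) = (\<Sum>x\<in>verts H. real (dist_V1_G2 x))"
    by (intro sum.cong gdist_V1_G2) (auto simp: verts_insert)
  finally show ?thesis .
qed

text \<open>
  This is where the values of \<open>d\<close> and \<open>t\<close> enter. The right-hand side is minus the distance between
  \<open>V1 a b\<close> and \<open>V2 a b\<close>, the only pair outside these sums.
\<close>

lemma balance:
  "(\<Sum>x\<in>verts H. real (dist_V1 x) + real (dist_V2 x) - real (dist_V2_G1 x)) = - 1"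
proof -
  \<comment> \<open>The two vertices outside \<open>H\<close> get weight zero, so that the sum can be split over the whole graph.\<close>
  define g where "g x = (if x \<in> {V1 a b, V2 a b} then 0
    else real (dist_V1 x) + real (dist_V2 x) - real (dist_V2_G1 x))" for x
  have "(\<Sum>x\<in>verts H. real (dist_V1 x) + real (dist_V2 x) - real (dist_V2_G1 x))
      = (\<Sum>x\<in>pverts (L_graph k m). g x)"
    by (rule sum.mono_neutral_cong_left) (auto simp: verts_H g_def)
  also have "\<dots> = (\<Sum>s\<le>d. real s - 1) + real t + (\<Sum>i\<in>{1..m}. if i = a then 2 else 1)
      + (\<Sum>i\<in>{1..m}. if i = a then \<Sum>j\<in>{1..k}. if j = b then 0 else 2 else - real k)
      + (\<Sum>i\<in>{1..m}. if i = a then \<Sum>j\<in>{1..k}. if j = b then 0 else 3 else 0)"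
    unfolding sum_L_graph
    by (intro arg_cong2[of _ _ _ _ "(+)"] sum.cong)
      (auto simp: g_def dist_V1_def dist_V2_def dist_V2_G1_def intro!: sum.cong)
  also have "\<dots> = (\<Sum>s\<le>d. real s) - (real d + 1) + real t + (2 + (real m - 1))
      + ((real k - 1) * 2 - (real m - 1) * real k) + (real k - 1) * 3"
    using a b by (simp add: sum_if_eq sum_subtractf)
  also have "(\<Sum>s\<le>d. real s) = real d * (real d + 1) / 2"
    using double_gauss_sum[of d, where ?'a = real] by (simp add: atMost_atLeast0)
  also have "real d * (real d + 1) / 2 - (real d + 1) + real t + (2 + (real m - 1))
      + ((real k - 1) * 2 - (real m - 1) * real k) + (real k - 1) * 3 = - 1"
    unfolding L_t_eq[OF m k] by (simp add: field_simps)
  finally show ?thesis .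
qed

lemma good_V1: "good_vertex G (V1 a b)"
  using a b connected_G1 balance
  by (simp add: good_vertex_def wiener_G wiener_G1 sum.distrib sum_subtractf)

text \<open>
  The total length gained is two, on the pair \<open>V1 a b\<close>, \<open>V a\<close>. The distances lost with \<open>V2 a b\<close>
  exceed this already at \<open>U 0\<close> and \<open>V1 a b\<close>, where they are two and one.
\<close>

lemma not_good_V2: "\<not> good_vertex G (V2 a b)"
proof -
  have "(\<Sum>x\<in>verts H. real (dist_V1_G2 x)) \<le> (\<Sum>x\<in>verts H. real (dist_V1 x) + (if x = V a then 2 else 0))"
    by (intro sum_mono) (auto simp: dist_V1_G2_def dist_V1_def)
  also have "\<dots> = (\<Sum>x\<in>verts H. real (dist_V1 x)) + 2"
    using a finite_verts_H by (simp add: sum.distrib verts_H)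
  finally have 1: "(\<Sum>x\<in>verts H. real (dist_V1_G2 x)) \<le> (\<Sum>x\<in>verts H. real (dist_V1 x)) + 2" .
  have "real (dist_V2 (U 0)) \<le> (\<Sum>x\<in>verts H. real (dist_V2 x))"
    using finite_verts_H by (intro member_le_sum) (auto simp: verts_H)
  then have "wiener_index G2 < wiener_index G"
    using 1 by (simp add: wiener_G wiener_G2 dist_V2_def)
  then show ?thesis by (simp add: good_vertex_def)
qed

end

section \<open>Counting the good vertices\<close>

text \<open>
  The bound on \<open>k\<close> is \<open>1 + 3 / (m - 6) > 1\<close>, so every block has a second path.
\<close>

lemma L_path_exists:
  assumes "m \<ge> 7" "real k \<ge> (real m - 3) / (real m - 6)" "i \<in> {1..m}" "j \<in> {1..k}"
  obtains j' where "L_path k m i j j'"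
proof -
  have "(real m - 3) / (real m - 6) > 1" using assms(1) by (simp add: field_simps)
  then have k: "k \<ge> 2" using assms(2) by linarith
  have "L_path k m i j (if j = 1 then 2 else 1)"
    using assms k by unfold_locales auto
  then show ?thesis by (rule that)
qed

lemma card_good_bounds:
  fixes k m :: nat
  assumes "m \<ge> 7" "real k \<ge> (real m - 3) / (real m - 6)"
  defines "G \<equiv> with_proj (L_graph k m)"
  shows "real m * real k \<le> real (card {v \<in> verts G. good_vertex G v})"
    and "real (card {v \<in> verts G. good_vertex G v}) \<le> real m * real k + real (L_d k m) + real m + 2"
    and "real (card (verts G)) = 2 * real m * real k + real (L_d k m) + real m + 2"
proof -
  define f where "f x = (if good_vertex G x then 1 else 0 :: real)" for x
  have fin: "finite (pverts (L_graph k m))"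
    unfolding pverts_L_graph_eq by auto
  have V1: "f (V1 i j) = 1" and V2: "f (V2 i j) = 0" if "i \<in> {1..m}" "j \<in> {1..k}" for i j
    using L_path_exists[OF assms(1,2) that] L_path.good_V1 L_path.not_good_V2
    unfolding f_def G_def by metis+
  have "real (card {v \<in> verts G. good_vertex G v}) = (\<Sum>x\<in>pverts (L_graph k m). f x)"
    using fin by (simp add: f_def G_def sum.If_cases Int_def)
  also have "\<dots> = (\<Sum>s\<le>L_d k m. f (U s)) + f U' + (\<Sum>i\<in>{1..m}. f (V i)) + real m * real k"
    by (simp add: sum_L_graph V1 V2)
  finally have card: "real (card {v \<in> verts G. good_vertex G v}) = \<dots>" .
  have f: "0 \<le> f x" "f x \<le> 1" for x by (auto simp: f_def)
  have "0 \<le> (\<Sum>s\<le>L_d k m. f (U s))" "0 \<le> (\<Sum>i\<in>{1..m}. f (V i))"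
    by (intro sum_nonneg f)+
  then show "real m * real k \<le> real (card {v \<in> verts G. good_vertex G v})"
    unfolding card using f(1)[of U'] by linarith
  have "(\<Sum>s\<le>L_d k m. f (U s)) \<le> (\<Sum>s\<le>L_d k m. 1)" "(\<Sum>i\<in>{1..m}. f (V i)) \<le> (\<Sum>i\<in>{1..m}. 1)"
    by (intro sum_mono f)+
  then show "real (card {v \<in> verts G. good_vertex G v}) \<le> real m * real k + real (L_d k m) + real m + 2"
    unfolding card using f(2)[of U'] by simp
  have "real (card (verts G)) = (\<Sum>x\<in>pverts (L_graph k m). 1)"
    by (simp add: G_def)
  then show "real (card (verts G)) = 2 * real m * real k + real (L_d k m) + real m + 2"
    unfolding sum_L_graph by simp
qed

lemma L_d_le: "real (L_d k m) \<le> (sqrt (8 * real k * real m + 33) + 1) / 2"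
proof -
  have "L_d k m \<le> nat \<lfloor>(sqrt (8 * real k * real m + 33) + 1) / 2\<rfloor>"
    unfolding L_d_def by (intro nat_mono floor_mono divide_right_mono add_right_mono) simp_all
  also have "real \<dots> \<le> (sqrt (8 * real k * real m + 33) + 1) / 2"
    by (intro of_nat_floor) simp
  finally show ?thesis by simp
qed

theorem corollary2:
  fixes m :: nat
  assumes "m \<ge> 7"
  shows "(\<lambda>k. good_proportion (with_proj (L_graph k m))) \<longlonglongrightarrow> 1 / 2"
proof -
  define e where "e k = ((sqrt (8 * real k * real m + 33) + 1) / 2 + real m + 2) / real k" for k
  have "real m > 0" using assms by simp
  then have e: "e \<longlonglongrightarrow> 0"
    unfolding e_def by real_asymp
  \<comment> \<open>For \<open>k \<ge> 4\<close> the bound \<open>(m - 3) / (m - 6)\<close>, which is largest at \<open>m = 7\<close>, is met.\<close>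
  have "norm (good_proportion (with_proj (L_graph k m)) - 1 / 2) \<le> e k" if "k \<ge> 4" for k
  proof -
    let ?G = "with_proj (L_graph k m)"
    define c where "c = real (card {v \<in> verts ?G. good_vertex ?G v})"
    define r where "r = real (L_d k m) + real m + 2"
    define n where "n = 2 * real m * real k + r"
    have "(real m - 3) / (real m - 6) \<le> 4"
      using assms by (simp add: field_simps)
    then have "real k \<ge> (real m - 3) / (real m - 6)"
      using that by simp
    note b = card_good_bounds[OF assms this]
    \<comment> \<open>\<open>r\<close> counts the vertices outside the two large classes; only their status is left open.\<close>
    have c: "real m * real k \<le> c" "c \<le> real m * real k + r"
      using b(1,2) by (simp_all add: c_def r_def)
    have r: "0 \<le> r" "r / real k \<le> e k"
      using L_d_le[of k m] by (auto simp: r_def e_def intro!: divide_right_mono)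
    have "1 * real k \<le> real m * real k"
      using assms by (intro mult_right_mono) auto
    then have n: "real k \<le> n" "0 < real k"
      using that r(1) unfolding n_def mult.assoc by linarith+
    have "c - n / 2 = (c - real m * real k) - r / 2"
      by (simp add: n_def field_simps)
    then have "\<bar>c - n / 2\<bar> \<le> r"
      using c r(1) by (intro abs_leI) linarith+
    have "good_proportion ?G - 1 / 2 = (c - n / 2) / n"
      using n b(3) by (simp add: good_proportion_def c_def n_def r_def field_simps)
    then have "\<bar>good_proportion ?G - 1 / 2\<bar> = \<bar>c - n / 2\<bar> / n"
      using n by simp
    also have "\<dots> \<le> r / real k"
      using \<open>\<bar>c - n / 2\<bar> \<le> r\<close> n r by (intro frac_le) auto
    finally show ?thesis using r(2) by simp
  qed
  then have "norm (good_proportion (with_proj (L_graph k m)) - 1 / 2) \<le> norm (e k) * 1"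
    if "k \<ge> 4" for k
    using that abs_ge_self[of "e k"] by (fastforce intro: order_trans)
  then have "(\<lambda>k. good_proportion (with_proj (L_graph k m)) - 1 / 2) \<longlonglongrightarrow> 0"
    by (intro tendsto_0_le[OF e, where K = 1]) (auto simp: eventually_sequentially)
  then show ?thesis by (rule LIM_zero_cancel)
qed

end
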